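(* Let $\mathcal{K}\subset\mathbb{Z}_{\max}^n$ be a semimodule with finite volume. Then, for all $A\in\mathbb{Z}_{\max}^{n\times n}$ and $B\in \mathbb{Z}_{\max}^{n\times p}$, the maximal (geometrically) $(A,B)$-invariant semimodule $\mathcal{K}^*$ contained in $\mathcal{K}$ is finitely generated. Moreover, if the sequence of semimodules $\{\mathcal{X}_r\}_{r\geq 1}$ is defined by $\mathcal{X}_1=\mathcal{K}$ and $\mathcal{X}_{r+1}=\varphi(\mathcal{X}_r)$ for all $r\geq 1$, then $\mathcal{K}^*=\mathcal{X}_k$ for some $k\leq \operatorname{vol}(\mathcal{K})+1$.
   Context: $\mathbb{Z}_{\max}$ is the semiring $(\mathbb{Z}\cup\{-\infty\},\oplus,\otimes)$ with $\oplus=\max$ and $\otimes=+$; its zero element is $-\infty$ and its unit is $0$. Matrix-vector products and sums are taken in this semiring: $(Ax)_i=\max_j(A_{ij}+x_j)$, $(x\oplus y)_i=\max(x_i,y_i)$, and scalars act by $(\lambda x)_i=\lambda+x_i$. A semimodule $\mathcal{X}\subset\mathbb{Z}_{\max}^n$ means a subsemimodule: a subset containing the zero vector $(-\infty,\ldots,-\infty)^T$ and closed under $(x,y)\mapsto \lambda x\oplus\mu y$ for all $\lambda,\mu\in\mathbb{Z}_{\max}$. It is finitely generated if it consists of all finite $\oplus$-linear combinations of finitely many of its elements. The volume of a semimodule $\mathcal{K}\subset\mathbb{Z}_{\max}^n$ is the cardinality $\operatorname{vol}(\mathcal{K})=\operatorname{card}\{x\in\mathcal{K}\mid \max_{1\le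 i\le n}x_i=0\}$. A semimodule $\mathcal{X}\subset\mathbb{Z}_{\max}^n$ is (geometrically) $(A,B)$-invariant if for all $x\in\mathcal{X}$ there exists $u\in\mathbb{Z}_{\max}^p$ such that $Ax\oplus Bu\in\mathcal{X}$. $\mathcal{K}^*$ denotes the maximal (i.e. largest for inclusion) such semimodule contained in $\mathcal{K}$. The map $\varphi$ on subsemimodules of $\mathbb{Z}_{\max}^n$ is $\varphi(\mathcal{X})=\mathcal{X}\cap A^{-1}(\mathcal{X}\ominus\mathcal{B})$, where $\mathcal{B}=\operatorname{Im}B$ is the subsemimodule generated by the columns of $B$, $A^{-1}(\mathcal{Y})=\{u\mid Au\in\mathcal{Y}\}$, and $\mathcal{Z}\ominus\mathcal{Y}=\{u\mid \exists y\in\mathcal{Y},\ u\oplus y\in\mathcal{Z}\}$. *)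

theory Defs
  imports "HOL-Analysis.Finite_Cartesian_Product"
begin

datatype zmax = MInf | Fin int

instantiation zmax :: linorder
begin

fun less_eq_zmax :: "zmax \<Rightarrow> zmax \<Rightarrow> bool" where
  "MInf \<le> y \<longleftrightarrow> True"
| "Fin a \<le> MInf \<longleftrightarrow> False"
| "Fin a \<le> Fin b \<longleftrightarrow> a \<le> b"

definition less_zmax :: "zmax \<Rightarrow> zmax \<Rightarrow> bool" where
  "x < y \<longleftrightarrow> x \<le> y \<and> \<not> y \<le> (x :: zmax)"

instance
proof
  fix x y z :: zmax
  show "x < y \<longleftrightarrow> x \<le> y \<and> \<not> y \<le> x"
    by (rule less_zmax_def)
  show "x \<le> x"
    by (cases x) auto
  show "x \<le> z" if "x \<le> y" "y \<le> z"
    using that by (cases x; cases y; cases z) auto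
  show "x = y" if "x \<le> y" "y \<le> x"
    using that by (cases x; cases y) auto
  show "x \<le> y \<or> y \<le> x"
    by (cases x; cases y) auto
qed

end

text \<open>
  The ring operations on \<^typ>\<open>zmax\<close> are the max-plus ones: \<open>+\<close> is the maximum, \<open>*\<close> is the
  addition of integers, \<open>0\<close> is minus infinity and \<open>1\<close> is the integer zero.  Hence \<open>x + y\<close>,
  \<open>c *s x\<close>, \<open>A *v x\<close> and finite sums on vectors over \<^typ>\<open>zmax\<close> have their max-plus meaning.
\<close>

instantiation zmax :: comm_semiring_1
begin

definition zero_zmax :: zmax where "0 = MInf"

definition one_zmax :: zmax where "1 = Fin 0"

definition plus_zmax :: "zmax \<Rightarrow> zmax \<Rightarrow> zmax" where "x + y = max x (y :: zmax)"

fun times_zmax :: "zmax \<Rightarrow> zmax \<Rightarrow> zmax" where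
  "Fin a * Fin b = Fin (a + b)"
| "MInf * y = MInf"
| "x * MInf = MInf"

instance
proof
  fix a b c :: zmax
  show "a + b + c = a + (b + c)"
    by (simp add: plus_zmax_def max.assoc)
  show "a + b = b + a"
    by (simp add: plus_zmax_def max.commute)
  show "0 + a = a"
    by (simp add: plus_zmax_def zero_zmax_def max_def)
  show "a * b * c = a * (b * c)"
    by (cases a; cases b; cases c) simp_all
  show "a * b = b * a"
    by (cases a; cases b) simp_all
  show "1 * a = a"
    by (cases a) (simp_all add: one_zmax_def)
  show "(a + b) * c = a * c + b * c"
    by (cases a; cases b; cases c) (simp_all add: plus_zmax_def max_def)
  show "0 * a = 0"
    by (simp add: zero_zmax_def)
  show "a * 0 = 0"
    by (cases a) (simp_all add: zero_zmax_def)
  show "(0::zmax) \<noteq> 1"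
    by (simp add: zero_zmax_def one_zmax_def)
qed

end

definition subsemimodule :: "(zmax ^ 'n) set \<Rightarrow> bool" where
  "subsemimodule X \<longleftrightarrow> 0 \<in> X \<and> (\<forall>x\<in>X. \<forall>y\<in>X. \<forall>a b. a *s x + b *s y \<in> X)"

definition generated :: "(zmax ^ 'n) set \<Rightarrow> (zmax ^ 'n) set" where
  "generated S = {\<Sum>v\<in>T. c v *s v | T c. finite T \<and> T \<subseteq> S}"

definition finitely_generated :: "(zmax ^ 'n) set \<Rightarrow> bool" where
  "finitely_generated X \<longleftrightarrow> (\<exists>S. finite S \<and> S \<subseteq> X \<and> X = generated S)"

definition normalized_vectors :: "(zmax ^ 'n) set \<Rightarrow> (zmax ^ 'n) set" where
  "normalized_vectors K = {x \<in> K. Max (range (($) x)) = Fin 0}"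

definition finite_volume :: "(zmax ^ 'n) set \<Rightarrow> bool" where
  "finite_volume K \<longleftrightarrow> finite (normalized_vectors K)"

text \<open>As \<^const>\<open>card\<close> is \<open>0\<close> on infinite sets, this is meaningful only for finite volume.\<close>

definition volume :: "(zmax ^ 'n) set \<Rightarrow> nat" where
  "volume K = card (normalized_vectors K)"

definition invariant :: "zmax ^ 'n ^ 'n \<Rightarrow> zmax ^ 'p ^ 'n \<Rightarrow> (zmax ^ 'n) set \<Rightarrow> bool" where
  "invariant A B X \<longleftrightarrow> (\<forall>x\<in>X. \<exists>u. A *v x + B *v u \<in> X)"

definition set_ominus :: "(zmax ^ 'n) set \<Rightarrow> (zmax ^ 'n) set \<Rightarrow> (zmax ^ 'n) set"
    (infixl \<open>\<ominus>\<close> 65) where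
  "Z \<ominus> Y = {u. \<exists>y\<in>Y. u + y \<in> Z}"

definition phi :: "zmax ^ 'n ^ 'n \<Rightarrow> zmax ^ 'p ^ 'n \<Rightarrow> (zmax ^ 'n) set \<Rightarrow> (zmax ^ 'n) set" where
  "phi A B X = X \<inter> (\<lambda>u. A *v u) -` (X \<ominus> generated (columns B))"

text \<open>The greatest element is taken for inclusion; it exists by \<open>max_invariant_greatest\<close> below.\<close>

definition max_invariant ::
    "zmax ^ 'n ^ 'n \<Rightarrow> zmax ^ 'p ^ 'n \<Rightarrow> (zmax ^ 'n) set \<Rightarrow> (zmax ^ 'n) set" where
  "max_invariant A B K = (GREATEST X. subsemimodule X \<and> invariant A B X \<and> X \<subseteq> K)"

lemma matrix_vector_mult_sum_smult:
  fixes A :: "zmax ^ 'm ^ 'n" and f :: "'a \<Rightarrow> zmax ^ 'm"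
  shows "A *v (\<Sum>v\<in>T. c v *s f v) = (\<Sum>v\<in>T. c v *s (A *v f v))"
proof (induction T rule: infinite_finite_induct)
  case (insert v T)
  have "A *v (c v *s f v) = c v *s (A *v f v)"
    by (simp add: vec_eq_iff matrix_vector_mult_def sum_distrib_left mult.left_commute)
  with insert show ?case
    by (simp add: matrix_vector_right_distrib)
qed (simp_all add: vec_eq_iff matrix_vector_mult_def)

lemma subsemimodule_sum:
  assumes "subsemimodule X" "\<And>v. v \<in> T \<Longrightarrow> f v \<in> X"
  shows "(\<Sum>v\<in>T. c v *s f v) \<in> X"
  using assms(2)
proof (induction T rule: infinite_finite_induct)
  case (insert v T)
  then have "c v *s f v + 1 *s (\<Sum>v\<in>T. c v *s f v) \<in> X"
    using assms(1) unfolding subsemimodule_def by blast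
  with insert show ?case by simp
qed (use assms(1) in \<open>simp_all add: subsemimodule_def\<close>)

lemma generated_base: "v \<in> S \<Longrightarrow> v \<in> generated S"
  unfolding generated_def
  by (rule CollectI, rule exI[of _ "{v}"], rule exI[of _ "\<lambda>_. 1"]) simp

lemma subsemimodule_generated: "subsemimodule (generated S)"
  unfolding subsemimodule_def
proof (intro conjI ballI allI)
  show "0 \<in> generated S"
    unfolding generated_def by (rule CollectI, rule exI[of _ "{}"]) simp
next
  fix x y :: "zmax ^ 'a" and a b :: zmax
  assume "x \<in> generated S" "y \<in> generated S"
  then obtain T c U d where
    T: "finite T" "T \<subseteq> S" "x = (\<Sum>v\<in>T. c v *s v)" and
    U: "finite U" "U \<subseteq> S" "y = (\<Sum>v\<in>U. d v *s v)"
    unfolding generated_def by blast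
  define c' where "c' v = (if v \<in> T then c v else 0)" for v
  define d' where "d' v = (if v \<in> U then d v else 0)" for v
  have x: "x = (\<Sum>v\<in>T \<union> U. c' v *s v)"
    unfolding T(3) c'_def using T(1) U(1) by (intro sum.mono_neutral_cong_left) auto
  have y: "y = (\<Sum>v\<in>T \<union> U. d' v *s v)"
    unfolding U(3) d'_def using T(1) U(1) by (intro sum.mono_neutral_cong_left) auto
  have "a *s x + b *s y = (\<Sum>v\<in>T \<union> U. (a * c' v + b * d' v) *s v)"
    unfolding x y
    by (simp add: vec_eq_iff sum_distrib_left sum.distrib distrib_right mult.assoc)
  then show "a *s x + b *s y \<in> generated S"
    unfolding generated_def using T(1,2) U(1,2)
    by (intro CollectI exI[of _ "T \<union> U"] exI[of _ "\<lambda>v. a * c' v + b * d' v"]) simp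
qed

lemma max_invariant_greatest:
  shows "subsemimodule K \<Longrightarrow> subsemimodule (max_invariant A B K)"
    and "subsemimodule K \<Longrightarrow> invariant A B (max_invariant A B K)"
    and "subsemimodule K \<Longrightarrow> max_invariant A B K \<subseteq> K"
    and "subsemimodule K \<Longrightarrow> subsemimodule X \<Longrightarrow> invariant A B X \<Longrightarrow> X \<subseteq> K
           \<Longrightarrow> X \<subseteq> max_invariant A B K"
proof -
  let ?P = "\<lambda>X. subsemimodule X \<and> invariant A B X \<and> X \<subseteq> K"
  define G where "G = generated (\<Union> (Collect ?P))"
  have greatest: "X \<subseteq> G" if "?P X" for X
  proof
    fix x assume "x \<in> X"
    with that have "x \<in> \<Union> (Collect ?P)" by (intro UnionI[of X]) simp_all
    then show "x \<in> G" unfolding G_def by (rule generated_base)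
  qed
  have "?P G" if K: "subsemimodule K"
  proof (intro conjI)
    show "subsemimodule G"
      unfolding G_def by (rule subsemimodule_generated)
    show "G \<subseteq> K"
    proof
      fix x assume "x \<in> G"
      then obtain T c where T: "T \<subseteq> \<Union> (Collect ?P)" and x: "x = (\<Sum>v\<in>T. c v *s v)"
        unfolding G_def generated_def by blast
      show "x \<in> K"
        unfolding x by (rule subsemimodule_sum[OF K]) (use T in blast)
    qed
    show "invariant A B G"
      unfolding invariant_def
    proof
      fix x
      assume "x \<in> G"
      then obtain T c where T: "T \<subseteq> \<Union> (Collect ?P)" and x: "x = (\<Sum>v\<in>T. c v *s v)"
        unfolding G_def generated_def by blast
      have "\<forall>v\<in>T. \<exists>u. A *v v + B *v u \<in> G"
      proof
        fix v assume "v \<in> T"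
        with T obtain X where X: "?P X" "v \<in> X" by blast
        then obtain u where "A *v v + B *v u \<in> X"
          unfolding invariant_def by blast
        with greatest[OF X(1)] show "\<exists>u. A *v v + B *v u \<in> G" by blast
      qed
      then obtain u where u: "\<forall>v\<in>T. A *v v + B *v u v \<in> G"
        unfolding bchoice_iff by blast
      have "A *v x + B *v (\<Sum>v\<in>T. c v *s u v) = (\<Sum>v\<in>T. c v *s (A *v v + B *v u v))"
        unfolding x matrix_vector_mult_sum_smult
        by (simp add: vector_add_ldistrib sum.distrib)
      also have "\<dots> \<in> G"
        by (rule subsemimodule_sum) (use u in \<open>simp_all add: G_def subsemimodule_generated\<close>)
      finally show "\<exists>u. A *v x + B *v u \<in> G" by blast
    qed
  qed
  then have G: "?P G" "max_invariant A B K = G" if "subsemimodule K"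
    using that greatest unfolding max_invariant_def by (auto intro!: Greatest_equality)
  show "subsemimodule K \<Longrightarrow> subsemimodule (max_invariant A B K)"
    and "subsemimodule K \<Longrightarrow> invariant A B (max_invariant A B K)"
    and "subsemimodule K \<Longrightarrow> max_invariant A B K \<subseteq> K"
    using G by auto
  show "X \<subseteq> max_invariant A B K"
    if "subsemimodule K" "subsemimodule X" "invariant A B X" "X \<subseteq> K"
    using G(2) greatest that by auto
qed

end

theory Submission
  imports Defs
begin

text \<open>
  A subsemimodule is determined by its normalized vectors, because every nonzero vector is the
  scalar multiple, by its largest entry, of a normalized one.  So the subsemimodules of a
  semimodule of finite volume are finitely generated, and strict inclusion among them strictly
  decreases the volume.  The sequence of the \<open>X r\<close> decreases, hence it repeats within
  \<open>volume K + 1\<close> steps, and a fixed point of \<open>phi\<close> is invariant.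
\<close>

lemma subsemimodule_smult:
  assumes "subsemimodule X" "x \<in> X"
  shows "c *s x \<in> X"
proof -
  have "c *s x + 0 *s x \<in> X"
    using assms unfolding subsemimodule_def by blast
  then show ?thesis by simp
qed

lemma generated_subset:
  assumes "subsemimodule X" "S \<subseteq> X"
  shows "generated S \<subseteq> X"
  using assms by (auto simp: generated_def intro!: subsemimodule_sum)

text \<open>Translation by an integer is monotone, so it commutes with the maximum of a finite
  nonempty set. This allows vectors to be normalized by scaling.\<close>

lemma Max_range_times_Fin:
  fixes x :: "zmax ^ 'n"
  shows "Max (range (($) (Fin a *s x))) = Fin a * Max (range (($) x))"
proof -
  have "mono (\<lambda>y. Fin a * y)"
  proof (rule monoI)
    show "Fin a * y \<le> Fin a * z" if "y \<le> z" for y z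
      using that by (cases y; cases z) auto
  qed
  moreover have "range (($) (Fin a *s x)) = (\<lambda>y. Fin a * y) ` range (($) x)"
    by (simp add: image_image)
  ultimately show ?thesis
    by (simp add: mono_Max_commute)
qed

lemma ex_scalar_normalized_vector:
  fixes X :: "(zmax ^ 'n) set"
  assumes "subsemimodule X" "x \<in> X" "x \<noteq> 0"
  obtains c v where "v \<in> normalized_vectors X" "x = c *s v"
proof (cases "Max (range (($) x))")
  case MInf
  have "x $ i = MInf" for i
  proof -
    have "x $ i \<le> MInf"
      unfolding MInf[symmetric] by (rule Max_ge) simp_all
    then show ?thesis by (cases "x $ i") auto
  qed
  then have "x = 0"
    by (simp add: vec_eq_iff zero_zmax_def)
  with assms(3) show ?thesis by blast
next
  case (Fin m)
  \<comment> \<open>The scalar \<open>Fin (- m)\<close> is the inverse of \<open>Fin m\<close>, the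
    largest entry of \<open>x\<close>: it shifts the maximum to \<open>Fin 0\<close>, and
    \<open>Fin m\<close> undoes the shift.\<close>
  have "Fin (- m) *s x \<in> normalized_vectors X"
    unfolding normalized_vectors_def mem_Collect_eq Max_range_times_Fin Fin
    using subsemimodule_smult[OF assms(1,2)] by simp
  moreover have "x = Fin m *s (Fin (- m) *s x)"
    by (simp add: vector_smult_assoc flip: one_zmax_def)
  ultimately show ?thesis by (rule that)
qed

lemma generated_normalized_vectors:
  fixes X :: "(zmax ^ 'n) set"
  assumes X: "subsemimodule X"
  shows "generated (normalized_vectors X) = X"
proof
  show "generated (normalized_vectors X) \<subseteq> X"
    by (rule generated_subset[OF X]) (auto simp: normalized_vectors_def)
  show "X \<subseteq> generated (normalized_vectors X)"
  proof
    fix x assume x: "x \<in> X"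
    show "x \<in> generated (normalized_vectors X)"
    proof (cases "x = 0")
      case True
      then show ?thesis
        using subsemimodule_generated unfolding subsemimodule_def by blast
    next
      case False
      then obtain c v where "v \<in> normalized_vectors X" "x = c *s v"
        using ex_scalar_normalized_vector[OF X x] by metis
      then show ?thesis
        by (simp add: subsemimodule_smult subsemimodule_generated generated_base)
    qed
  qed
qed

lemma normalized_vectors_mono:
  "X \<subseteq> Y \<Longrightarrow> normalized_vectors X \<subseteq> normalized_vectors Y"
  by (auto simp: normalized_vectors_def)

lemma finitely_generated_if_finite_volume:
  assumes "subsemimodule X" "finite_volume X"
  shows "finitely_generated X"
  using assms generated_normalized_vectors[OF assms(1)]
  unfolding finitely_generated_def finite_volume_def
  by (intro exI[of _ "normalized_vectors X"]) (auto simp: normalized_vectors_def)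

lemma finite_volume_subset:
  "finite_volume Y \<Longrightarrow> X \<subseteq> Y \<Longrightarrow> finite_volume X"
  unfolding finite_volume_def using finite_subset normalized_vectors_mono by blast

lemma volume_strict_mono:
  assumes "subsemimodule X" "subsemimodule Y" "finite_volume Y" "X \<subset> Y"
  shows "volume X < volume Y"
proof -
  \<comment> \<open>Equal sets of normalized vectors would generate equal subsemimodules, against
    the strict inclusion.\<close>
  have "normalized_vectors X \<noteq> normalized_vectors Y"
    using assms generated_normalized_vectors by (metis psubset_eq)
  then show ?thesis
    using assms normalized_vectors_mono[of X Y]
    unfolding volume_def finite_volume_def by (intro psubset_card_mono) auto
qed

text \<open>The columns are the images of the unit vectors, and \<open>B\<close> commutes with
  linear combinations. This turns membership in the column span into the existence of a control
  \<open>u\<close>.\<close>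

lemma generated_columns:
  fixes B :: "zmax ^ 'p ^ 'n"
  shows "generated (columns B) = range ((*v) B)"
proof
  have col: "column i B = B *v axis i 1" for i
    by (simp add: vec_eq_iff column_def matrix_vector_mult_def axis_def if_distrib sum.delta
        cong: if_cong)
  show "generated (columns B) \<subseteq> range ((*v) B)"
  proof
    fix x assume "x \<in> generated (columns B)"
    then obtain T c where T: "T \<subseteq> columns B" and x: "x = (\<Sum>v\<in>T. c v *s v)"
      unfolding generated_def by blast
    \<comment> \<open>\<open>T\<close> is a set of vectors, not of indices, so a preimage is chosen
      for each of its elements.\<close>
    have "\<forall>v\<in>T. \<exists>u. v = B *v u"
      using T col unfolding columns_def by blast
    then obtain u where u: "\<forall>v\<in>T. v = B *v u v"
      unfolding bchoice_iff by blast
    have "x = (\<Sum>v\<in>T. c v *s (B *v u v))"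
      unfolding x using u by (intro sum.cong) auto
    then show "x \<in> range ((*v) B)"
      by (simp flip: matrix_vector_mult_sum_smult)
  qed
  show "range ((*v) B) \<subseteq> generated (columns B)"
  proof
    fix x assume "x \<in> range ((*v) B)"
    then obtain u where "x = B *v u" by blast
    then have x: "x = (\<Sum>i\<in>UNIV. u $ i *s column i B)"
      by (simp add: matrix_mult_sum)
    \<comment> \<open>Columns may repeat, so the sum over indices is not directly one over a set of
      vectors; closure under sums avoids merging coefficients.\<close>
    show "x \<in> generated (columns B)"
      unfolding x
      by (intro subsemimodule_sum subsemimodule_generated generated_base) (auto simp: columns_def)
  qed
qed

lemma phi_eq: "phi A B X = {x \<in> X. \<exists>u. A *v x + B *v u \<in> X}"
  unfolding phi_def set_ominus_def generated_columns by auto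

lemma phi_subset: "phi A B X \<subseteq> X"
  unfolding phi_eq by blast

lemma phi_mono: "X \<subseteq> Y \<Longrightarrow> phi A B X \<subseteq> phi A B Y"
  unfolding phi_eq by blast

text \<open>Invariance says exactly that \<open>X \<subseteq> phi A B X\<close>; the other inclusion
  always holds.\<close>

lemma invariant_iff_phi_eq: "invariant A B X \<longleftrightarrow> phi A B X = X"
  unfolding invariant_def phi_eq by blast

lemma subsemimodule_phi:
  assumes X: "subsemimodule X"
  shows "subsemimodule (phi A B X)"
  unfolding subsemimodule_def
proof (intro conjI ballI allI)
  have zero: "0 \<in> X"
    using X unfolding subsemimodule_def by blast
  have "A *v 0 + B *v 0 = 0"
    by (simp add: vec_eq_iff matrix_vector_mult_def)
  with zero show "0 \<in> phi A B X"
    unfolding phi_eq by (metis (mono_tags, lifting) mem_Collect_eq)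
next
  fix x y a b
  assume "x \<in> phi A B X" "y \<in> phi A B X"
  then obtain u w where x: "x \<in> X" "A *v x + B *v u \<in> X" and y: "y \<in> X" "A *v y + B *v w \<in> X"
    unfolding phi_eq by blast
  \<comment> \<open>The control for a combination of states is the same combination of their
    controls.\<close>
  have "A *v (a *s x + b *s y) + B *v (a *s u + b *s w)
      = a *s (A *v x + B *v u) + b *s (A *v y + B *v w)"
    by (simp add: vec_eq_iff matrix_vector_mult_def distrib_left sum.distrib sum_distrib_left
        mult.left_commute add_ac)
  also have "\<dots> \<in> X"
    using X x(2) y(2) unfolding subsemimodule_def by blast
  finally show "a *s x + b *s y \<in> phi A B X"
    using X x(1) y(1) unfolding phi_eq subsemimodule_def by blast
qed

theorem theorem2:
  fixes K :: "(zmax ^ 'n) set" and A :: "zmax ^ 'n ^ 'n" and B :: "zmax ^ 'p ^ 'n"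
  assumes "subsemimodule K" and "finite_volume K"
  shows "finitely_generated (max_invariant A B K) \<and>
    (\<forall>X :: nat \<Rightarrow> (zmax ^ 'n) set.
      X 1 = K \<and> (\<forall>r\<ge>1. X (r + 1) = phi A B (X r)) \<longrightarrow>
      (\<exists>k. 1 \<le> k \<and> k \<le> volume K + 1 \<and> max_invariant A B K = X k))"
proof (intro conjI allI impI)
  let ?M = "max_invariant A B K"
  note M = max_invariant_greatest[OF assms(1), where A = A and B = B]
  show "finitely_generated ?M"
    using finitely_generated_if_finite_volume M(1) finite_volume_subset[OF assms(2) M(3)] by blast
  fix X :: "nat \<Rightarrow> (zmax ^ 'n) set"
  assume X: "X 1 = K \<and> (\<forall>r\<ge>1. X (r + 1) = phi A B (X r))"
  then have X1: "X 1 = K" by blast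
  have Xstep: "X (Suc r) = phi A B (X r)" if "1 \<le> r" for r
    using X that by simp
  have Xr: "subsemimodule (X r) \<and> X r \<subseteq> K \<and> ?M \<subseteq> X r" if "1 \<le> r" for r
    using that
  proof (induction r rule: dec_induct)
    case base
    then show ?case using X1 assms(1) M(3) by simp
  next
    case (step r)
    \<comment> \<open>\<open>?M\<close> is a fixed point of \<open>phi A B\<close>, so monotonicity
      keeps it below every iterate.\<close>
    have "?M \<subseteq> phi A B (X r)"
      using phi_mono[of ?M "X r" A B] M(2) step.IH unfolding invariant_iff_phi_eq by simp
    then show ?case
      unfolding Xstep[OF step.hyps(1)]
      using step.IH subsemimodule_phi phi_subset[of A B "X r"] by (meson order_trans)
  qed
  have "\<exists>k. 1 \<le> k \<and> k \<le> volume K + 1 \<and> phi A B (X k) = X k"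
  proof (rule ccontr)
    assume none: "\<not> ?thesis"
    \<comment> \<open>Indexing starts at 1, so \<open>X (Suc r)\<close> arises after
      \<open>r\<close> steps, each strict by \<open>none\<close> and hence losing at least one
      normalized vector. At \<open>r = volume K + 1\<close> the bound is absurd.\<close>
    have "volume (X (Suc r)) + r \<le> volume K" if "r \<le> volume K + 1" for r
      using that
    proof (induction r)
      case 0
      then show ?case using X1 by simp
    next
      case (Suc r)
      have "X (Suc (Suc r)) \<subset> X (Suc r)"
        using none Suc.prems phi_subset[of A B "X (Suc r)"]
        by (simp add: Xstep psubset_eq)
      then have "volume (X (Suc (Suc r))) < volume (X (Suc r))"
        using Xr finite_volume_subset[OF assms(2)] by (intro volume_strict_mono) simp_all
      with Suc show ?case by simp
    qed
    from this[of "volume K + 1"] show False by simp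
  qed
  then obtain k where k: "1 \<le> k" "k \<le> volume K + 1" "phi A B (X k) = X k" by blast
  \<comment> \<open>A fixed point is an invariant subsemimodule of \<open>K\<close>, so maximality
    of \<open>?M\<close> applies.\<close>
  have "X k \<subseteq> ?M"
    using M(4) Xr[OF k(1)] k(3) unfolding invariant_iff_phi_eq by blast
  with Xr[OF k(1)] have "?M = X k" by blast
  with k(1,2) show "\<exists>k. 1 \<le> k \<and> k \<le> volume K + 1 \<and> ?M = X k" by blast
qed

end
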